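(* Let $r,t,k$ be positive integers with $1\le t<r$ and $k>\frac{t}{2t+1}(2r+1)$. Then there is a $(2t+1)$-connected $(2r+1)$-regular graph having no $2k$-factor.
   Context: "Graph" means finite multigraph: loops and multiple edges are allowed, and a loop contributes $2$ to the degree of its vertex. An $\ell$-factor of a graph is an $\ell$-regular spanning subgraph. A graph is $m$-connected if it has more than $m$ vertices and deleting any fewer than $m$ vertices leaves a connected graph. *)

theory Defs
  imports Complex_Main "HOL-Library.Uprod"
begin

text \<open>
  Edges carry their own identity, so parallel edges are distinct edges with the same ends,
  and a loop at \<open>v\<close> is an edge with ends \<open>Upair v v\<close>.
\<close>

record ('v, 'e) mgraph =
  verts :: "'v set"
  edges :: "'e set"
  ends  :: "'e \<Rightarrow> 'v uprod"

definition multigraph :: "('v, 'e) mgraph \<Rightarrow> bool" where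
  "multigraph G \<longleftrightarrow>
     finite (verts G) \<and> finite (edges G) \<and> (\<forall>e\<in>edges G. set_uprod (ends G e) \<subseteq> verts G)"

text \<open>A loop at \<open>v\<close> lies in both of the sets below, hence contributes 2.\<close>

definition degree :: "('v, 'e) mgraph \<Rightarrow> 'v \<Rightarrow> nat" where
  "degree G v =
     card {e \<in> edges G. v \<in> set_uprod (ends G e)} + card {e \<in> edges G. ends G e = Upair v v}"

definition regular :: "nat \<Rightarrow> ('v, 'e) mgraph \<Rightarrow> bool" where
  "regular d G \<longleftrightarrow> (\<forall>v\<in>verts G. degree G v = d)"

definition adj :: "('v, 'e) mgraph \<Rightarrow> ('v \<times> 'v) set" where
  "adj G = {(u, v). \<exists>e\<in>edges G. ends G e = Upair u v}"

definition connected_graph :: "('v, 'e) mgraph \<Rightarrow> bool" where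
  "connected_graph G \<longleftrightarrow>
     verts G \<noteq> {} \<and> (\<forall>u\<in>verts G. \<forall>v\<in>verts G. (u, v) \<in> (adj G)\<^sup>*)"

definition delete_verts :: "('v, 'e) mgraph \<Rightarrow> 'v set \<Rightarrow> ('v, 'e) mgraph" where
  "delete_verts G X =
     \<lparr> verts = verts G - X,
       edges = {e \<in> edges G. set_uprod (ends G e) \<inter> X = {}},
       ends = ends G \<rparr>"

definition vertex_connected :: "nat \<Rightarrow> ('v, 'e) mgraph \<Rightarrow> bool" where
  "vertex_connected m G \<longleftrightarrow>
     card (verts G) > m \<and>
     (\<forall>X. X \<subseteq> verts G \<and> card X < m \<longrightarrow> connected_graph (delete_verts G X))"

definition spanning_subgraph :: "('v, 'e) mgraph \<Rightarrow> ('v, 'e) mgraph \<Rightarrow> bool" where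
  "spanning_subgraph H G \<longleftrightarrow>
     multigraph H \<and> verts H = verts G \<and> edges H \<subseteq> edges G \<and>
     (\<forall>e\<in>edges H. ends H e = ends G e)"

definition is_factor :: "nat \<Rightarrow> ('v, 'e) mgraph \<Rightarrow> ('v, 'e) mgraph \<Rightarrow> bool" where
  "is_factor l H G \<longleftrightarrow> spanning_subgraph H G \<and> regular l H"

end

theory Submission
  imports Defs "HOL-Library.Nat_Bijection"
begin

text \<open>
  The graph is the complete bipartite graph with sides \<open>A\<close> of size \<open>2 * t + 1\<close> and \<open>B\<close> of size
  \<open>2 * r + 1\<close>, with \<open>r - t\<close> loops added at every vertex of \<open>B\<close>. Without loops the vertices of \<open>B\<close>
  have degree \<open>2 * t + 1\<close>, so the loops raise all degrees to \<open>2 * r + 1\<close>; and fewer than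
  \<open>2 * t + 1\<close> deletions exhaust neither side, so what is left is still connected.

  The obstruction to an even factor is parity. A loop counts twice, so a vertex of \<open>B\<close> has even
  degree in a subgraph only if it keeps an even number of its \<open>2 * t + 1\<close> edges to \<open>A\<close>, hence at
  most \<open>2 * t\<close> of them (\<open>even_factor_bound\<close>). On the other hand \<open>A\<close> spans no edge, so the
  vertices of \<open>A\<close> draw all of their degree from these edges. Counting the edges of a \<open>2 * k\<close>-factor
  between the sides both ways gives \<open>2 * k * (2 * t + 1) \<le> 2 * t * (2 * r + 1)\<close>, which is
  exactly what the lower bound on \<open>k\<close> excludes.
\<close>

text \<open>
  The vertices below \<open>a\<close> form one side, the others the other side, which carries \<open>s\<close> loops at each
  vertex. An edge is the code of a pair \<open>(i, j)\<close> whose second component is an end on the looped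
  side; the first component is the other end if it is below \<open>a\<close>, and otherwise only numbers the
  loops at \<open>j\<close>.
\<close>

definition looped_biclique :: "nat \<Rightarrow> nat \<Rightarrow> nat \<Rightarrow> (nat, nat) mgraph" where
  "looped_biclique a b s =
     \<lparr> verts = {..<a + b},
       edges = prod_encode ` ({..<a + s} \<times> {a..<a + b}),
       ends = (\<lambda>e. case prod_decode e of (i, j) \<Rightarrow> Upair (if i < a then i else j) j) \<rparr>"

lemma multigraph_looped_biclique: "multigraph (looped_biclique a b s)"
  by (auto simp: multigraph_def looped_biclique_def)

lemma spanning_subgraph_refl: "multigraph G \<Longrightarrow> spanning_subgraph G G"
  by (simp add: spanning_subgraph_def)

lemma ends_subgraph:
  assumes "spanning_subgraph H (looped_biclique a b s)" and "prod_encode (i, j) \<in> edges H"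
  shows "ends H (prod_encode (i, j)) = Upair (if i < a then i else j) j"
  using assms by (auto simp: spanning_subgraph_def looped_biclique_def)

lemma Collect_edges_subgraph:
  assumes "spanning_subgraph H (looped_biclique a b s)"
  shows "{e \<in> edges H. P e} =
    prod_encode ` {(i, j). i < a + s \<and> a \<le> j \<and> j < a + b \<and>
                           prod_encode (i, j) \<in> edges H \<and> P (prod_encode (i, j))}"
  using assms by (fastforce simp: spanning_subgraph_def looped_biclique_def)

lemma degree_loopless_side:
  assumes H: "spanning_subgraph H (looped_biclique a b s)" and "i < a"
  shows "degree H i = card {j \<in> {a..<a + b}. prod_encode (i, j) \<in> edges H}"
proof -
  let ?J = "{j \<in> {a..<a + b}. prod_encode (i, j) \<in> edges H}"
  have "{e \<in> edges H. i \<in> set_uprod (ends H e)} = (\<lambda>j. prod_encode (i, j)) ` ?J"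
    using \<open>i < a\<close>
    by (auto simp: Collect_edges_subgraph[OF H] ends_subgraph[OF H] split: if_splits)
  moreover have "{e \<in> edges H. ends H e = Upair i i} = {}"
    using \<open>i < a\<close>
    by (auto simp: Collect_edges_subgraph[OF H] ends_subgraph[OF H] split: if_splits)
  moreover have "card ((\<lambda>j. prod_encode (i, j)) ` ?J) = card ?J"
    by (rule card_image) (auto simp: inj_on_def)
  ultimately show ?thesis
    by (simp only: degree_def card.empty add_0_right)
qed

lemma degree_looped_side:
  assumes H: "spanning_subgraph H (looped_biclique a b s)" and "a \<le> j" "j < a + b"
  shows "degree H j = card {i \<in> {..<a}. prod_encode (i, j) \<in> edges H}
                      + 2 * card {i \<in> {a..<a + s}. prod_encode (i, j) \<in> edges H}"
proof -
  let ?I = "{i \<in> {..<a}. prod_encode (i, j) \<in> edges H}"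
  let ?L = "{i \<in> {a..<a + s}. prod_encode (i, j) \<in> edges H}"
  have inj: "card ((\<lambda>i. prod_encode (i, j)) ` X) = card X" for X
    by (rule card_image) (auto simp: inj_on_def)
  have "{e \<in> edges H. j \<in> set_uprod (ends H e)} = (\<lambda>i. prod_encode (i, j)) ` (?I \<union> ?L)"
    using assms(2-)
    by (auto simp: Collect_edges_subgraph[OF H] ends_subgraph[OF H] split: if_splits)
  moreover have "card (?I \<union> ?L) = card ?I + card ?L"
    by (rule card_Un_disjoint) auto
  moreover have "{e \<in> edges H. ends H e = Upair j j} = (\<lambda>i. prod_encode (i, j)) ` ?L"
    using assms(2-)
    by (auto simp: Collect_edges_subgraph[OF H] ends_subgraph[OF H] split: if_splits)
  ultimately show ?thesis
    by (simp add: degree_def inj)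
qed

lemma regular_looped_biclique:
  assumes "b = a + 2 * s"
  shows "regular b (looped_biclique a b s)"
proof -
  let ?G = "looped_biclique a b s"
  have G: "spanning_subgraph ?G ?G"
    by (intro spanning_subgraph_refl multigraph_looped_biclique)
  have mem: "prod_encode (i, j) \<in> edges ?G \<longleftrightarrow> i < a + s \<and> a \<le> j \<and> j < a + b" for i j
    by (auto simp: looped_biclique_def)
  have "degree ?G v = b" if "v < a" for v
  proof -
    have "{j \<in> {a..<a + b}. prod_encode (v, j) \<in> edges ?G} = {a..<a + b}"
      using that by (auto simp: mem)
    then show ?thesis
      using degree_loopless_side[OF G that] by simp
  qed
  moreover have "degree ?G v = b" if "a \<le> v" "v < a + b" for v
  proof -
    have "{i \<in> {..<a}. prod_encode (i, v) \<in> edges ?G} = {..<a}"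
      "{i \<in> {a..<a + s}. prod_encode (i, v) \<in> edges ?G} = {a..<a + s}"
      using that by (auto simp: mem)
    then show ?thesis
      using degree_looped_side[OF G that] assms by simp
  qed
  moreover have "verts ?G = {..<a + b}"
    by (simp add: looped_biclique_def)
  ultimately show ?thesis
    unfolding regular_def by (metis lessThan_iff not_le)
qed

text \<open>
  A set of fewer than \<open>a \<le> b\<close> vertices covers neither side; a survivor \<open>p\<close> below \<open>a\<close> and a
  survivor \<open>q\<close> from \<open>a\<close> on then link all remaining vertices.
\<close>

lemma vertex_connected_looped_biclique:
  assumes "0 < a" and "a \<le> b"
  shows "vertex_connected a (looped_biclique a b s)"
  unfolding vertex_connected_def
proof (intro conjI allI impI)
  show "a < card (verts (looped_biclique a b s))"
    using assms by (simp add: looped_biclique_def)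
next
  fix X
  assume X: "X \<subseteq> verts (looped_biclique a b s) \<and> card X < a"
  let ?D = "delete_verts (looped_biclique a b s) X"
  have fin: "finite X"
    using X by (auto simp: looped_biclique_def intro: finite_subset)
  have "\<not> {..<a} \<subseteq> X" "\<not> {a..<a + b} \<subseteq> X"
    using X assms card_mono[OF fin, of "{..<a}"] card_mono[OF fin, of "{a..<a + b}"] by auto
  then obtain p q where p: "p < a" "p \<notin> X" and q: "a \<le> q" "q < a + b" "q \<notin> X"
    by (auto simp: subset_iff)
  have V: "verts ?D = {..<a + b} - X"
    by (simp add: delete_verts_def looped_biclique_def)
  have cross: "(i, j) \<in> adj ?D \<and> (j, i) \<in> adj ?D"
    if "i < a" "i \<notin> X" "a \<le> j" "j < a + b" "j \<notin> X" for i j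
  proof -
    have "prod_encode (i, j) \<in> edges ?D" "ends ?D (prod_encode (i, j)) = Upair i j"
      using that by (auto simp: delete_verts_def looped_biclique_def)
    moreover have "Upair i j = Upair j i"
      by simp
    ultimately show ?thesis
      unfolding adj_def by (metis (mono_tags, lifting) case_prodI mem_Collect_eq)
  qed
  have to_p: "(v, p) \<in> (adj ?D)\<^sup>* \<and> (p, v) \<in> (adj ?D)\<^sup>*" if "v \<in> verts ?D" for v
  proof (cases "v < a")
    case True
    then have "(v, q) \<in> adj ?D" "(q, v) \<in> adj ?D" "(q, p) \<in> adj ?D" "(p, q) \<in> adj ?D"
      using that p q cross V by auto
    then show ?thesis
      by (meson r_into_rtrancl rtrancl.rtrancl_into_rtrancl)
  next
    case False
    then show ?thesis
      using that p cross[of p v] V by auto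
  qed
  have "p \<in> verts ?D"
    using p V by simp
  then show "connected_graph ?D"
    unfolding connected_graph_def using to_p by (blast intro: rtrancl_trans)
qed

text \<open>
  Since loops contribute evenly, each vertex of the looped side uses an even number of its \<open>a\<close>
  edges to the other side, hence not all of them when \<open>a\<close> is odd. The inequality is the resulting
  double count of the edges of the factor between the two sides.
\<close>

lemma even_factor_bound:
  assumes F: "is_factor l H (looped_biclique a b s)" and "even l" and "odd a"
  shows "l * a \<le> (a - 1) * b"
proof -
  let ?inc = "\<lambda>i j. prod_encode (i, j) \<in> edges H"
  have H: "spanning_subgraph H (looped_biclique a b s)"
    using F by (simp add: is_factor_def)
  have deg: "degree H v = l" if "v < a + b" for v
    using F that by (simp add: is_factor_def regular_def spanning_subgraph_def looped_biclique_def)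
  have bound: "card {i \<in> {..<a}. ?inc i j} \<le> a - 1" if "j \<in> {a..<a + b}" for j
  proof -
    have "even (card {i \<in> {..<a}. ?inc i j})"
      using degree_looped_side[OF H, of j] deg[of j] that \<open>even l\<close> by auto
    moreover have "card {i \<in> {..<a}. ?inc i j} \<le> a"
      using card_mono[of "{..<a}" "{i \<in> {..<a}. ?inc i j}"] by auto
    ultimately show ?thesis
      using \<open>odd a\<close> by (cases "card {i \<in> {..<a}. ?inc i j} = a") auto
  qed
  have "card {j \<in> {a..<a + b}. ?inc i j} = l" if "i < a" for i
    using degree_loopless_side[OF H that] deg[of i] that by simp
  then have "l * a = (\<Sum>i<a. card {j \<in> {a..<a + b}. ?inc i j})"
    by (subst sum.cong[OF refl, where h = "\<lambda>_. l"]) auto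
  also have "\<dots> = (\<Sum>j\<in>{a..<a + b}. card {i \<in> {..<a}. ?inc i j})"
    by (rule sum_multicount_gen) auto
  also have "\<dots> \<le> (\<Sum>j\<in>{a..<a + b}. a - 1)"
    by (rule sum_mono) (rule bound)
  also have "\<dots> = (a - 1) * b"
    by simp
  finally show ?thesis .
qed

theorem theorem3p3:
  fixes r t k :: nat
  assumes "r > 0" and "t > 0" and "k > 0"
    and "1 \<le> t" and "t < r"
    and "real k > real t / real (2 * t + 1) * real (2 * r + 1)"
  shows "\<exists>G :: (nat, nat) mgraph.
           multigraph G \<and> vertex_connected (2 * t + 1) G \<and> regular (2 * r + 1) G \<and>
           \<not> (\<exists>H. is_factor (2 * k) H G)"
proof (intro exI conjI)
  let ?G = "looped_biclique (2 * t + 1) (2 * r + 1) (r - t)"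
  show "multigraph ?G"
    by (rule multigraph_looped_biclique)
  show "vertex_connected (2 * t + 1) ?G"
    using \<open>t < r\<close> by (intro vertex_connected_looped_biclique) auto
  show "regular (2 * r + 1) ?G"
    using \<open>t < r\<close> by (intro regular_looped_biclique) simp
  show "\<not> (\<exists>H. is_factor (2 * k) H ?G)"
  proof
    assume "\<exists>H. is_factor (2 * k) H ?G"
    then obtain H where "is_factor (2 * k) H ?G" ..
    then have "2 * k * (2 * t + 1) \<le> (2 * t + 1 - 1) * (2 * r + 1)"
      by (rule even_factor_bound) auto
    then have "k * (2 * t + 1) \<le> t * (2 * r + 1)"
      by simp
    then have "real k * real (2 * t + 1) \<le> real t * real (2 * r + 1)"
      by (metis of_nat_le_iff of_nat_mult)
    moreover have "real t * real (2 * r + 1) < real k * real (2 * t + 1)"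
      using assms(6) by (simp add: field_simps)
    ultimately show False
      by linarith
  qed
qed

end
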